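(* Let $y:[0,T]\to\mathbb{R}^N$ be the solution of the initial-value problem $y'(t)=\Phi(t,y(t))$, $y(0)=v$, $t\in[0,T]$, where for every $k=0,1,2,\dots$ one has $\Phi(t,y)=-A_k y+f_k(y)+g(t)$ for all $y\in\mathbb{R}^N$, $t\ge 0$. Assume that there are constants $L\ge 0$, $C>0$, $\omega\ge 0$ such that for all $k$ $$\|f_k(u)-f_k(w)\|\le L\|u-w\|\quad \forall u,w\in\mathbb{R}^N,\qquad \|\exp(-tA_k)\|\le Ce^{-\omega t}\quad\forall t\ge 0,$$ and that, for a certain constant $\delta\in(0,1)$, $C L T\varphi_1(-\omega T)\le\delta<1$. Let $\tilde y_0,\tilde y_1,\tilde y_2,\dots:[0,T]\to\mathbb{R}^N$ be the iterates of the inexact waveform relaxation, that is, $\tilde y_k(0)=v$ for all $k$, and for each $k=0,1,\dots$ the function $\tilde y_{k+1}$ is an approximate solution of the linear initial-value problem $z'(t)=-A_kz(t)+f_k(\tilde y_k(t))+g(t)$, $z(0)=v$, $t\in[0,T]$, with residual $$r^{\mathsf{lin}}_{k+1}(t)=-A_k\tilde y_{k+1}(t)+f_k(\tilde y_k(t))+g(t)-\tilde y_{k+1}'(t),\quad t\in[0,T].$$ Suppose that, with a constant $\eta\in(0,1)$, for every $k=0,1,\dots$ one of the following two conditions holds: (a) $\|r^{\mathsf{lin}}_{k+1}(t)\|\le\eta\max_{s\in[0,t]}\|f_k(\tilde y_{k+1}(s))-f_k(\tilde y_k(s))\|$ for $t\in[0,T]$; (b) $\|r^{\mathsf{lin}}_{k+1}(t)\|\le\eta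 L\max_{s\in[0,t]}\|\tilde y_{k+1}(s)-\tilde y_k(s)\|$ for $t\in[0,T]$. Then the errors $\tilde\epsilon_k(t)=y(t)-\tilde y_k(t)$ satisfy, for $k=0,1,\dots$, $$\|\tilde\epsilon_{k+1}(t)\|\le\frac{(1+\eta)\,C L t\varphi_1(-\omega t)}{1-\eta\, C L t\varphi_1(-\omega t)}\max_{s\in[0,t]}\|\tilde\epsilon_k(s)\|,\qquad\forall t\in[0,T].$$ Moreover, if $\eta<\dfrac{1-\delta}{2\delta}$, then the inexact iteration converges to the solution for $t\in[0,T]$, i.e. $\tilde y_k(t)\to y(t)$ as $k\to\infty$ for all $t\in[0,T]$.
   Context: $N\ge 1$, $T>0$, $v\in\mathbb{R}^N$ are given; $\Phi:\mathbb{R}\times\mathbb{R}^N\to\mathbb{R}^N$; $A_k\in\mathbb{R}^{N\times N}$; $f_k:\mathbb{R}^N\to\mathbb{R}^N$; $g:\mathbb{R}\to\mathbb{R}^N$ is continuous; $\tilde y_0$ is a continuous initial guess on $[0,T]$ and $\tilde y_k$, $k\ge1$, are continuously differentiable on $[0,T]$. $\|\cdot\|$ is a vector norm on $\mathbb{C}^N$ or the corresponding induced matrix norm. The entire function $\varphi_1$ is given by $\varphi_1(z)=(e^z-1)/z$ for $z\ne 0$ and $\varphi_1(0)=1$. The approximate solutions $\tilde y_{k+1}$ may be produced by any (inner iterative) solver; only their initial value and their residual matter. *)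

theory Defs
  imports "HOL-Analysis.Analysis"
begin

(* An arbitrary vector norm on C^n, as opposed to the Euclidean norm built into the type. *)
definition is_vector_norm :: "(complex ^ 'n \<Rightarrow> real) \<Rightarrow> bool" where
  "is_vector_norm \<nu> \<longleftrightarrow>
     (\<forall>x. 0 \<le> \<nu> x) \<and>
     (\<forall>x. \<nu> x = 0 \<longleftrightarrow> x = 0) \<and>
     (\<forall>c x. \<nu> (c *s x) = cmod c * \<nu> x) \<and>
     (\<forall>x y. \<nu> (x + y) \<le> \<nu> x + \<nu> y)"

definition induced_norm :: "(complex ^ 'n \<Rightarrow> real) \<Rightarrow> complex ^ 'n ^ 'n \<Rightarrow> real" where
  "induced_norm \<nu> M = (SUP x\<in>{x. x \<noteq> 0}. \<nu> (M *v x) / \<nu> x)"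

definition cvec :: "real ^ 'n \<Rightarrow> complex ^ 'n" where
  "cvec x = (\<chi> i. complex_of_real (x $ i))"

definition cmat :: "real ^ 'n ^ 'n \<Rightarrow> complex ^ 'n ^ 'n" where
  "cmat M = map_matrix complex_of_real M"

(* The library's exp is not available on square matrices: multiplication on the
   type vec is componentwise.  The n-th power of A is the n-th iterate of (**) A
   applied to the identity matrix. *)
definition mat_exp :: "real ^ 'n ^ 'n \<Rightarrow> real ^ 'n ^ 'n" where
  "mat_exp A = (\<Sum>n. (1 / fact n) *\<^sub>R (((**) A ^^ n) (mat 1)))"

definition phi1 :: "'a::{real_normed_field,banach} \<Rightarrow> 'a" where
  "phi1 z = (if z = 0 then 1 else (exp z - 1) / z)"

(* Maximum over [0,t].  Max is restricted to finite sets, so this is the supremum;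
   it is attained when h is continuous on [0,t] and t \<ge> 0. *)
definition max_upto :: "real \<Rightarrow> (real \<Rightarrow> real) \<Rightarrow> real" where
  "max_upto t h = (SUP s\<in>{0..t}. h s)"

(* Continuous differentiability on [0,T], with one-sided derivatives at the end
   points (C1_differentiable_on demands two-sided ones). *)
definition cont_diff_on_interval :: "real \<Rightarrow> (real \<Rightarrow> real ^ 'n) \<Rightarrow> bool" where
  "cont_diff_on_interval T z \<longleftrightarrow>
     (\<forall>t\<in>{0..T}. z differentiable (at t within {0..T})) \<and>
     continuous_on {0..T} (\<lambda>t. vector_derivative z (at t within {0..T}))"

(* Residual of z as an approximate solution on [0,T] of z' = - A z + f (u t) + g t. *)
definition lin_residual ::
  "real \<Rightarrow> real ^ 'n ^ 'n \<Rightarrow> (real ^ 'n \<Rightarrow> real ^ 'n) \<Rightarrow> (real \<Rightarrow> real ^ 'n) \<Rightarrow>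
   (real \<Rightarrow> real ^ 'n) \<Rightarrow> (real \<Rightarrow> real ^ 'n) \<Rightarrow> real \<Rightarrow> real ^ 'n" where
  "lin_residual T A f g u z t =
     - (A *v z t) + f (u t) + g t - vector_derivative z (at t within {0..T})"

end

(* For e_{k+1} = y - yt_{k+1} one has e_{k+1}' = -A_k e_{k+1} + f_k(y) - f_k(yt_k) + r_{k+1} and
   e_{k+1}(0) = 0. Both residual conditions give |r_{k+1}| <= eta L (M_{k+1} + M_k) with the running
   maxima M_j of |e_j|, so the variation-of-constants bound yields
   M_{k+1} <= C L t phi_1(-omega t) ((1 + eta) M_k + eta M_{k+1}), which is solved for M_{k+1}.
   The condition on eta makes the resulting factor smaller than 1. *)
theory Submission
  imports Defs
begin

section \<open>Arbitrary norms on a Euclidean space\<close>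

text \<open>The norm of the theorem enters twice: as \<nu> on complex vectors, for the induced
  matrix norm, and as \<nu> composed with \<open>cvec\<close> on real vectors, for the errors. Both
  are instances of this locale. Nonnegativity is derived from \<open>0 = p (x + (- x))\<close> and
  symmetry.\<close>

locale equivalent_norm =
  fixes p :: "'a::euclidean_space \<Rightarrow> real"
  assumes zero_iff: "p x = 0 \<longleftrightarrow> x = 0"
    and scaleR: "p (c *\<^sub>R x) = \<bar>c\<bar> * p x"
    and triangle: "p (x + y) \<le> p x + p y"
begin

lemma zero [simp]: "p 0 = 0"
  by (simp add: zero_iff)

lemma minus: "p (- x) = p x"
  using scaleR[of "-1" x] by simp

lemma diff_commute: "p (x - y) = p (y - x)"
  using minus[of "x - y"] by simp

lemma nonneg [simp]: "0 \<le> p x"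
  using triangle[of x "- x"] minus[of x] by simp

lemma triangle_diff: "p (x - z) \<le> p (x - y) + p (y - z)"
  using triangle[of "x - y" "y - z"] by simp

lemma abs_diff_le: "\<bar>p x - p y\<bar> \<le> p (x - y)"
  using triangle[of "x - y" y] triangle[of "y - x" x] diff_commute[of x y] by simp

lemma sum_le: "p (\<Sum>i\<in>I. h i) \<le> (\<Sum>i\<in>I. p (h i))"
proof (induction I rule: infinite_finite_induct)
  case (insert i I)
  then show ?case using triangle[of "h i" "sum h I"] by simp
qed auto

text \<open>Expanding in the orthonormal basis bounds \<open>p x\<close> by the sum of the
  \<open>p b\<close>, since each coordinate is at most \<open>norm x\<close>. The summand 1 makes
  the constant visibly positive.\<close>

lemma upper_equivalence: "\<exists>K>0. \<forall>x. p x \<le> K * norm x"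
proof (intro exI conjI allI)
  show "0 < 1 + (\<Sum>b\<in>Basis. p b)"
    by (smt (verit) nonneg sum_nonneg)
  fix x
  have "p x = p (\<Sum>b\<in>Basis. (x \<bullet> b) *\<^sub>R b)"
    by (simp add: euclidean_representation)
  also have "\<dots> \<le> (\<Sum>b\<in>Basis. \<bar>x \<bullet> b\<bar> * p b)"
    by (rule order_trans[OF sum_le]) (simp add: scaleR)
  also have "\<dots> \<le> (\<Sum>b\<in>Basis. norm x * p b)"
    by (intro sum_mono mult_right_mono Basis_le_norm nonneg)
  also have "\<dots> \<le> (1 + (\<Sum>b\<in>Basis. p b)) * norm x"
    by (simp add: sum_distrib_left[symmetric] algebra_simps)
  finally show "p x \<le> (1 + (\<Sum>b\<in>Basis. p b)) * norm x" .
qed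

lemma continuous_on_compose:
  assumes "continuous_on S h"
  shows "continuous_on S (\<lambda>s. p (h s))"
proof -
  obtain K where K: "K > 0" "\<And>x. p x \<le> K * norm x"
    using upper_equivalence by blast
  have "K-lipschitz_on UNIV p"
  proof (rule lipschitz_onI)
    fix x y
    show "dist (p x) (p y) \<le> K * dist x y"
      using abs_diff_le[of x y] K(2)[of "x - y"] by (simp add: dist_norm)
  qed (use K in auto)
  then have "continuous_on UNIV p"
    by (rule lipschitz_on_continuous_on)
  from continuous_on_compose2[OF this assms] show ?thesis by simp
qed

text \<open>By compactness \<open>p\<close> attains its minimum on the unit sphere. This minimum is
  positive because \<open>p\<close> vanishes only at 0, and homogeneity carries the bound to all
  vectors.\<close>

lemma lower_equivalence: "\<exists>K>0. \<forall>x. norm x \<le> K * p x"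
proof -
  have "continuous_on (sphere 0 1) (\<lambda>x. p x)"
    by (rule continuous_on_compose) (rule continuous_on_id)
  moreover have "compact (sphere 0 1 :: 'a set)" "sphere 0 1 \<noteq> ({} :: 'a set)"
    by simp_all
  ultimately obtain z where z: "norm z = 1" "\<And>x. norm x = 1 \<Longrightarrow> p z \<le> p x"
    using continuous_attains_inf[of "sphere 0 1" p] by (auto simp: dist_norm)
  have pz: "p z > 0"
    using z(1) zero_iff[of z] nonneg[of z] by (smt (verit) norm_zero)
  show ?thesis
  proof (intro exI conjI allI)
    show "1 / p z > 0" using pz by simp
    fix x
    show "norm x \<le> 1 / p z * p x"
    proof (cases "x = 0")
      case False
      then have "p z \<le> p ((1 / norm x) *\<^sub>R x)"
        by (intro z(2)) simp
      then show ?thesis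
        using False pz by (simp add: scaleR field_simps)
    qed auto
  qed
qed

text \<open>The error estimates are in terms of \<open>p\<close>, while the limit refers to the
  topology of the type; the lower equivalence connects the two.\<close>

lemma tendsto_from_zero:
  assumes "(\<lambda>n. p (X n - l)) \<longlonglongrightarrow> 0"
  shows "X \<longlonglongrightarrow> l"
proof -
  obtain K where K: "\<And>x. norm x \<le> K * p x"
    using lower_equivalence by blast
  have "(\<lambda>n. K * p (X n - l)) \<longlonglongrightarrow> 0"
    by (rule tendsto_mult_right_zero[OF assms])
  then have "(\<lambda>n. X n - l) \<longlonglongrightarrow> 0"
    by (rule Lim_null_comparison[OF always_eventually[OF allI[OF K]]])
  then show ?thesis by (simp add: LIM_zero_iff)
qed

text \<open>The norm is the supremum of the linear functionals below it; each functional reduces the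
  claim to the scalar fundamental theorem of calculus.\<close>

lemma growth_bound:
  fixes w :: "real \<Rightarrow> 'a"
  assumes "a \<le> b"
    and w: "\<And>s. s \<in> {a..b} \<Longrightarrow> (w has_vector_derivative w' s) (at s within {a..b})"
    and \<psi>: "\<And>s. s \<in> {a..b} \<Longrightarrow> (\<psi> has_vector_derivative \<psi>' s) (at s within {a..b})"
    and le: "\<And>s. s \<in> {a..b} \<Longrightarrow> p (w' s) \<le> \<psi>' s"
  shows "p (w b - w a) \<le> \<psi> b - \<psi> a"
proof (rule ccontr)
  assume neg: "\<not> ?thesis"
  have \<psi>_int: "(\<psi>' has_integral (\<psi> b - \<psi> a)) {a..b}"
    by (rule fundamental_theorem_of_calculus[OF \<open>a \<le> b\<close> \<psi>])
  have \<psi>_nonneg: "0 \<le> \<psi> b - \<psi> a"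
    by (rule has_integral_nonneg[OF \<psi>_int]) (use le nonneg order_trans in blast)
  \<comment> \<open>The closed \<open>p\<close>-ball of radius \<open>c\<close> misses the increment
    of \<open>w\<close>. Since \<psi> does not decrease from \<open>a\<close> to \<open>b\<close>,
    \<open>c\<close> is positive, so the ball can be rescaled.\<close>
  obtain c where c: "\<psi> b - \<psi> a < c" "c < p (w b - w a)"
    using neg dense by (metis not_le)
  then have "c > 0" using \<psi>_nonneg by simp
  have "convex {x. p x \<le> c}"
  proof (rule convexI)
    fix x y and u v :: real
    assume xy: "x \<in> {x. p x \<le> c}" "y \<in> {x. p x \<le> c}" and uv: "0 \<le> u" "0 \<le> v" "u + v = 1"
    have "p (u *\<^sub>R x + v *\<^sub>R y) \<le> u * p x + v * p y"
      using triangle[of "u *\<^sub>R x" "v *\<^sub>R y"] uv by (simp add: scaleR)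
    also have "\<dots> \<le> u * c + v * c"
      using xy uv by (intro add_mono mult_left_mono) auto
    also have "\<dots> = c" using uv by (simp add: distrib_right[symmetric])
    finally show "u *\<^sub>R x + v *\<^sub>R y \<in> {x. p x \<le> c}" by simp
  qed
  moreover have "closed {x. p x \<le> c}"
    by (intro closed_Collect_le continuous_on_compose continuous_intros)
  \<comment> \<open>The hyperplane leaves the increment on its lower side. Changing the signs of
    \<open>n0\<close> and \<open>m0\<close> gives a functional \<open>n\<close> that exceeds
    \<open>m\<close> at the increment and stays below \<open>m\<close> on the ball.\<close>
  ultimately obtain n0 m0 where "n0 \<bullet> (w b - w a) < m0" "\<And>x. p x \<le> c \<Longrightarrow> n0 \<bullet> x > m0"
    using separating_hyperplane_closed_point[of "{x. p x \<le> c}" "w b - w a"] c by force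
  then obtain n m where n: "n \<bullet> (w b - w a) > m" "\<And>x. p x \<le> c \<Longrightarrow> n \<bullet> x < m"
    by (metis inner_minus_left neg_less_iff_less)
  have "m > 0" using n(2)[of 0] \<open>c > 0\<close> by simp
  \<comment> \<open>Scaling \<open>x\<close> to \<open>p\<close>-length \<open>c\<close> turns the
    separation into a bound of \<open>n\<close> by a multiple of \<open>p\<close>. After integration
    this bounds \<open>n\<close> at the increment by \<open>m\<close>, a contradiction.\<close>
  have functional: "n \<bullet> x \<le> m / c * p x" for x
  proof (cases "x = 0")
    case False
    then have "p x > 0" using zero_iff[of x] nonneg[of x] by linarith
    then have "n \<bullet> ((c / p x) *\<^sub>R x) < m"
      using \<open>c > 0\<close> by (intro n(2)) (simp add: scaleR)
    then show ?thesis using \<open>p x > 0\<close> \<open>c > 0\<close> by (simp add: field_simps)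
  qed simp
  have "((\<lambda>s. n \<bullet> w' s) has_integral (n \<bullet> w b - n \<bullet> w a)) {a..b}"
    by (rule fundamental_theorem_of_calculus[OF \<open>a \<le> b\<close>])
       (intro bounded_linear.has_vector_derivative[OF bounded_linear_inner_right] w)
  moreover have "((\<lambda>s. m / c * \<psi>' s) has_integral (m / c * (\<psi> b - \<psi> a))) {a..b}"
    by (rule has_integral_mult_right[OF \<psi>_int])
  moreover have "n \<bullet> w' s \<le> m / c * \<psi>' s" if "s \<in> {a..b}" for s
    using functional[of "w' s"] mult_left_mono[OF le[OF that], of "m / c"] \<open>m > 0\<close> \<open>c > 0\<close> by simp
  ultimately have "n \<bullet> w b - n \<bullet> w a \<le> m / c * (\<psi> b - \<psi> a)"
    by (rule has_integral_le)
  also have "\<dots> \<le> m / c * c"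
    using c(1) \<open>m > 0\<close> \<open>c > 0\<close> by (intro mult_left_mono) auto
  finally show False
    using n(1) \<open>c > 0\<close> by (simp add: inner_diff_right)
qed

end

section \<open>Matrix powers and the matrix exponential\<close>

definition mat_pow :: "real ^ 'n ^ 'n \<Rightarrow> nat \<Rightarrow> real ^ 'n ^ 'n" where
  "mat_pow A n = ((**) A ^^ n) (mat 1)"

lemma mat_pow_0 [simp]: "mat_pow A 0 = mat 1"
  and mat_pow_Suc: "mat_pow A (Suc n) = A ** mat_pow A n"
  by (simp_all add: mat_pow_def)

lemma mat_pow_Suc_right: "mat_pow A (Suc n) = mat_pow A n ** A"
  by (induction n) (simp_all add: mat_pow_Suc matrix_mul_assoc)

lemma mat_pow_scaleR: "mat_pow (z *\<^sub>R A) n = z ^ n *\<^sub>R mat_pow A n"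
  by (induction n)
     (simp_all add: mat_pow_Suc matrix_matrix_mult_def vec_eq_iff sum_distrib_left mult_ac)

text \<open>The operator norm is submultiplicative, and an entry is a component of the image of an
  axis vector. This yields the exponential series as a majorant for every entry.\<close>

lemma mat_pow_component_le: "\<bar>mat_pow A n $ i $ j\<bar> \<le> onorm ((*v) A) ^ n"
proof -
  have "norm (mat_pow A n *v x) \<le> onorm ((*v) A) ^ n * norm x" for x
  proof (induction n)
    case (Suc n)
    have "norm (mat_pow A (Suc n) *v x) \<le> onorm ((*v) A) * norm (mat_pow A n *v x)"
      by (simp add: mat_pow_Suc matrix_vector_mul_assoc[symmetric] onorm)
    also have "\<dots> \<le> onorm ((*v) A) * (onorm ((*v) A) ^ n * norm x)"
      by (intro mult_left_mono Suc onorm_pos_le) simp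
    finally show ?case by simp
  qed simp
  from this[of "axis j 1"] component_le_norm_cart[of "mat_pow A n *v axis j 1" i]
  show ?thesis by (simp add: matrix_vector_mult_basis column_def)
qed

lemma mat_exp_component_summable: "summable (\<lambda>n. mat_pow A n $ i $ j / fact n * z ^ n)" for z :: real
proof (rule summable_comparison_test')
  show "summable (\<lambda>n. (onorm ((*v) A) * \<bar>z\<bar>) ^ n /\<^sub>R fact n)"
    by (rule summable_exp_generic)
  show "norm (mat_pow A n $ i $ j / fact n * z ^ n) \<le> (onorm ((*v) A) * \<bar>z\<bar>) ^ n /\<^sub>R fact n" for n
    using mult_right_mono[OF mat_pow_component_le[of A n i j], of "\<bar>z\<bar> ^ n"]
    by (simp add: abs_mult power_abs power_mult_distrib divide_simps)
qed

text \<open>Each entry of the exponential is a scalar power series in \<open>z\<close>, so termwise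
  differentiation applies to it.\<close>

lemma mat_exp_component:
  "mat_exp (z *\<^sub>R A) $ i $ j = (\<Sum>n. mat_pow A n $ i $ j / fact n * z ^ n)"
proof -
  define S where "S = (\<chi> i j. \<Sum>n. mat_pow A n $ i $ j / fact n * z ^ n)"
  have "(\<lambda>n. (1 / fact n) *\<^sub>R mat_pow (z *\<^sub>R A) n) sums S"
    unfolding sums_def
  proof (intro vec_tendstoI)
    fix i j
    show "(\<lambda>n. (\<Sum>k<n. (1 / fact k) *\<^sub>R mat_pow (z *\<^sub>R A) k) $ i $ j) \<longlonglongrightarrow> S $ i $ j"
      using summable_LIMSEQ[OF mat_exp_component_summable[of A i j z]]
      by (simp add: S_def mat_pow_scaleR mult_ac)
  qed
  then show ?thesis
    by (simp add: mat_exp_def mat_pow_def[symmetric] sums_unique[symmetric] S_def)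
qed

lemma mat_exp_0 [simp]: "mat_exp 0 = (mat 1 :: real ^ 'n ^ 'n)"
proof -
  \<comment> \<open>Zero is written as a scalar multiple so that the entry formula applies at
    \<open>z = 0\<close>, where only the constant term survives.\<close>
  have "mat_exp (0 *\<^sub>R 0) $ i $ j = (mat 1 :: real ^ 'n ^ 'n) $ i $ j" for i j :: 'n
    unfolding mat_exp_component by (subst powser_zero) simp
  then show ?thesis by (simp add: vec_eq_iff)
qed

text \<open>Termwise differentiation. The factor \<open>A\<close> is split off on the right, so that
  in a product with a vector it acts directly on that vector and no commutation of \<open>A\<close>
  with its exponential has to be shown.\<close>

lemma mat_exp_has_derivative:
  "((\<lambda>z. mat_exp (z *\<^sub>R A) $ i $ j) has_real_derivative (mat_exp (z *\<^sub>R A) ** A) $ i $ j) (at z)"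
proof -
  \<comment> \<open>The factor \<open>Suc n\<close> produced by differentiation cancels against
    \<open>fact (Suc n)\<close>, leaving the next power of \<open>A\<close> over
    \<open>fact n\<close>.\<close>
  have "diffs (\<lambda>n. mat_pow A n $ i $ j / fact n) n = (\<Sum>k\<in>UNIV. mat_pow A n $ i $ k / fact n * A $ k $ j)"
    for n
  proof -
    have "diffs (\<lambda>n. mat_pow A n $ i $ j / fact n) n = mat_pow A (Suc n) $ i $ j / fact n"
      by (simp add: diffs_def del: of_nat_Suc)
    then show ?thesis
      by (simp add: mat_pow_Suc_right matrix_matrix_mult_def sum_divide_distrib)
  qed
  then have "(\<Sum>n. diffs (\<lambda>n. mat_pow A n $ i $ j / fact n) n * z ^ n)
      = (\<Sum>n. \<Sum>k\<in>UNIV. (mat_pow A n $ i $ k / fact n * z ^ n) * A $ k $ j)"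
    by (simp add: sum_distrib_right mult.assoc mult.commute[of "z ^ _"])
  also have "\<dots> = (\<Sum>k\<in>UNIV. \<Sum>n. (mat_pow A n $ i $ k / fact n * z ^ n) * A $ k $ j)"
    by (intro suminf_sum summable_mult2 mat_exp_component_summable)
  also have "\<dots> = (mat_exp (z *\<^sub>R A) ** A) $ i $ j"
    unfolding matrix_matrix_mult_def mat_exp_component vec_lambda_beta
    by (intro sum.cong refl suminf_mult2[symmetric] mat_exp_component_summable)
  finally show ?thesis
    using termdiffs_strong_converges_everywhere[OF mat_exp_component_summable[of A i j], of z]
    by (simp add: mat_exp_component)
qed

lemma has_vector_derivative_vec:
  fixes w :: "real \<Rightarrow> real ^ 'n"
  assumes "\<And>i. ((\<lambda>s. w s $ i) has_real_derivative w' $ i) (at s within S)"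
  shows "(w has_vector_derivative w') (at s within S)"
  unfolding has_vector_derivative_def has_derivative_componentwise_within[of w]
  using assms
  by (auto simp: Basis_vec_def inner_axis has_field_derivative_def mult.commute[of _ "w' $ _"])

text \<open>Product rule for the integrating factor. If \<open>e' = - (A *v e s) + d s\<close>, the
  bracket reduces to \<open>d s\<close>.\<close>

lemma mat_exp_mult_has_vector_derivative:
  assumes "(e has_vector_derivative e') (at s within S)"
  shows "((\<lambda>s. mat_exp ((s - t) *\<^sub>R A) *v e s) has_vector_derivative
           mat_exp ((s - t) *\<^sub>R A) *v (A *v e s + e')) (at s within S)"
proof (rule has_vector_derivative_vec)
  fix i
  have e: "((\<lambda>s. e s $ j) has_real_derivative e' $ j) (at s within S)" for j
    using bounded_linear.has_vector_derivative[OF bounded_linear_vec_nth assms]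
    by (simp add: has_real_derivative_iff_has_vector_derivative)
  have F: "((\<lambda>s. mat_exp ((s - t) *\<^sub>R A) $ i $ j) has_real_derivative
      (mat_exp ((s - t) *\<^sub>R A) ** A) $ i $ j) (at s within S)" for j
    using DERIV_chain2[where g = "\<lambda>s. s - t" and x = s and s = S and Db = 1, OF mat_exp_has_derivative[of A i j "s - t"]]
    by (simp add: DERIV_diff[OF DERIV_ident DERIV_const, simplified])
  have "((\<lambda>s. \<Sum>j\<in>UNIV. mat_exp ((s - t) *\<^sub>R A) $ i $ j * e s $ j) has_real_derivative
      (\<Sum>j\<in>UNIV. (mat_exp ((s - t) *\<^sub>R A) ** A) $ i $ j * e s $ j + e' $ j * mat_exp ((s - t) *\<^sub>R A) $ i $ j))
      (at s within S)"
    by (intro DERIV_sum DERIV_mult F e)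
  moreover have "(\<Sum>j\<in>UNIV. (mat_exp ((s - t) *\<^sub>R A) ** A) $ i $ j * e s $ j + e' $ j * mat_exp ((s - t) *\<^sub>R A) $ i $ j)
      = ((mat_exp ((s - t) *\<^sub>R A) ** A) *v e s + mat_exp ((s - t) *\<^sub>R A) *v e') $ i"
    by (simp add: matrix_vector_mult_def sum.distrib mult_ac)
  moreover have "(mat_exp ((s - t) *\<^sub>R A) ** A) *v e s + mat_exp ((s - t) *\<^sub>R A) *v e'
      = mat_exp ((s - t) *\<^sub>R A) *v (A *v e s + e')"
    by (simp add: matrix_vector_mul_assoc matrix_vector_right_distrib)
  moreover have "(\<lambda>s. (mat_exp ((s - t) *\<^sub>R A) *v e s) $ i)
      = (\<lambda>s. \<Sum>j\<in>UNIV. mat_exp ((s - t) *\<^sub>R A) $ i $ j * e s $ j)"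
    by (simp add: matrix_vector_mult_def)
  ultimately show "((\<lambda>s. (mat_exp ((s - t) *\<^sub>R A) *v e s) $ i) has_real_derivative
      (mat_exp ((s - t) *\<^sub>R A) *v (A *v e s + e')) $ i) (at s within S)"
    by simp
qed

section \<open>Variation of constants\<close>

text \<open>Thus \<open>t * phi1 (- \<omega> * t)\<close> is the integral of
  \<open>exp (- \<omega> * s)\<close> over \<open>s\<close> from 0 to \<open>t\<close>, which is how
  \<open>phi1\<close> enters the error bound.\<close>

lemma mult_phi1_has_derivative:
  fixes t \<omega> :: real
  shows
  "((\<lambda>t. t * phi1 (- \<omega> * t)) has_real_derivative exp (- \<omega> * t)) (at t within S)"
proof (cases "\<omega> = 0")
  case False
  then have "(\<lambda>t. t * phi1 (- \<omega> * t)) = (\<lambda>t. (1 - exp (- \<omega> * t)) / \<omega>)"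
    by (auto simp: phi1_def field_simps)
  then show ?thesis
    using False by (auto intro!: derivative_eq_intros)
qed (simp add: phi1_def)

lemma mult_phi1_mono:
  fixes s t \<omega> :: real
  assumes "s \<le> t"
  shows "s * phi1 (- \<omega> * s) \<le> t * phi1 (- \<omega> * t)"
proof (rule DERIV_nonneg_imp_nondecreasing[of s t "\<lambda>t. t * phi1 (- \<omega> * t)", OF assms])
  fix x
  show "\<exists>y. ((\<lambda>t. t * phi1 (- \<omega> * t)) has_real_derivative y) (at x) \<and> 0 \<le> y"
    using mult_phi1_has_derivative[of \<omega> x UNIV] by (intro exI[of _ "exp (- \<omega> * x)"]) simp
qed

text \<open>The product of the integrating factor with \<open>e\<close> equals \<open>e t\<close> at
  \<open>s = t\<close> and vanishes at \<open>s = 0\<close>, and its derivative is the propagated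
  source. \<open>growth_bound\<close> then estimates \<open>e t\<close> without forming a
  vector-valued integral.\<close>

lemma duhamel_bound:
  fixes p :: "real ^ 'n \<Rightarrow> real"
  assumes norm: "equivalent_norm p"
    and t: "0 \<le> t" and "0 \<le> C"
    and e: "\<And>s. s \<in> {0..t} \<Longrightarrow> (e has_vector_derivative (- (A *v e s) + d s)) (at s within {0..t})"
    and e0: "e 0 = 0"
    and semigroup: "\<And>s x. 0 \<le> s \<Longrightarrow> p (mat_exp ((- s) *\<^sub>R A) *v x) \<le> C * exp (- \<omega> * s) * p x"
    and d: "\<And>s. s \<in> {0..t} \<Longrightarrow> p (d s) \<le> B"
  shows "p (e t) \<le> C * B * (t * phi1 (- \<omega> * t))"
proof -
  interpret equivalent_norm p by (rule norm)
  let ?w = "\<lambda>s. mat_exp ((s - t) *\<^sub>R A) *v e s"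
  \<comment> \<open>A primitive in \<open>s\<close> of
    \<open>C * B * exp (- \<omega> * (t - s))\<close>, chosen to vanish at
    \<open>s = t\<close>.\<close>
  let ?\<psi> = "\<lambda>s. - (C * B) * ((t - s) * phi1 (- \<omega> * (t - s)))"
  have "p (?w t - ?w 0) \<le> ?\<psi> t - ?\<psi> 0"
  proof (rule growth_bound[OF t])
    fix s assume s: "s \<in> {0..t}"
    show "(?w has_vector_derivative mat_exp ((s - t) *\<^sub>R A) *v d s) (at s within {0..t})"
      using mat_exp_mult_has_vector_derivative[OF e[OF s], of t A] by simp
    have "((\<lambda>s. (t - s) * phi1 (- \<omega> * (t - s))) has_real_derivative exp (- \<omega> * (t - s)) * (- 1))
        (at s within {0..t})"
      by (rule DERIV_chain2[OF mult_phi1_has_derivative]) (auto intro!: derivative_eq_intros)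
    from DERIV_cmult[OF this, of "- (C * B)"]
    show "(?\<psi> has_vector_derivative C * B * exp (- \<omega> * (t - s))) (at s within {0..t})"
      by (simp add: has_real_derivative_iff_has_vector_derivative)
    have "p (mat_exp ((s - t) *\<^sub>R A) *v d s) \<le> C * exp (- \<omega> * (t - s)) * p (d s)"
      using semigroup[of "t - s" "d s"] s by simp
    also have "\<dots> \<le> C * exp (- \<omega> * (t - s)) * B"
      using d[OF s] \<open>0 \<le> C\<close> by (intro mult_left_mono) auto
    finally show "p (mat_exp ((s - t) *\<^sub>R A) *v d s) \<le> C * B * exp (- \<omega> * (t - s))"
      by (simp add: mult_ac)
  qed
  then show ?thesis by (simp add: e0)
qed

section \<open>Real vectors inside complex ones and the induced matrix norm\<close>

lemma cvec_add: "cvec (x + y) = cvec x + cvec y"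
  and cvec_scaleR: "cvec (c *\<^sub>R x) = complex_of_real c *s cvec x"
  and cvec_eq_0_iff: "cvec x = 0 \<longleftrightarrow> x = 0"
  by (simp_all add: cvec_def vec_eq_iff)

lemma cvec_mult: "cvec (M *v x) = cmat M *v cvec x"
  by (simp add: cvec_def cmat_def vec_eq_iff matrix_vector_mult_def map_matrix_def)

lemma equivalent_norm_vector_norm:
  fixes \<nu> :: "complex ^ 'n \<Rightarrow> real"
  assumes "is_vector_norm \<nu>"
  shows "equivalent_norm \<nu>"
proof
  fix x :: "complex ^ 'n" and c :: real
  have "c *\<^sub>R x = complex_of_real c *s x"
    by (rule vec_eq_iff[THEN iffD2])
       (simp only: vector_scaleR_component vector_smult_component, simp add: scaleR_conv_of_real)
  then show "\<nu> (c *\<^sub>R x) = \<bar>c\<bar> * \<nu> x"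
    using assms by (simp add: is_vector_norm_def)
qed (use assms in \<open>simp_all add: is_vector_norm_def\<close>)

lemma equivalent_norm_cvec:
  assumes "is_vector_norm \<nu>"
  shows "equivalent_norm (\<lambda>x. \<nu> (cvec x))"
  using assms
  by unfold_locales (simp_all add: is_vector_norm_def cvec_add cvec_scaleR cvec_eq_0_iff)

text \<open>A real \<open>SUP\<close> dominates its members once they are bounded above. The two
  equivalence constants and the Euclidean operator norm bound the quotients.\<close>

lemma induced_norm_bound:
  assumes "is_vector_norm \<nu>"
  shows "\<nu> (M *v x) \<le> induced_norm \<nu> M * \<nu> x"
proof (cases "x = 0")
  case False
  interpret equivalent_norm \<nu> by (rule equivalent_norm_vector_norm[OF assms])
  obtain K where K: "K > 0" "\<And>x. \<nu> x \<le> K * norm x" using upper_equivalence by blast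
  obtain K' where K': "K' > 0" "\<And>x. norm x \<le> K' * \<nu> x" using lower_equivalence by blast
  have pos: "\<nu> z > 0" if "z \<noteq> 0" for z
    using that zero_iff[of z] nonneg[of z] by linarith
  have "\<nu> (M *v z) / \<nu> z \<le> K * (onorm ((*v) M) * K')" if "z \<noteq> 0" for z
  proof -
    have "\<nu> (M *v z) \<le> K * norm (M *v z)" by (rule K)
    also have "\<dots> \<le> K * (onorm ((*v) M) * norm z)"
      using K by (intro mult_left_mono onorm) auto
    also have "\<dots> \<le> K * (onorm ((*v) M) * (K' * \<nu> z))"
      using K by (intro mult_left_mono K' onorm_pos_le) auto
    finally show ?thesis using pos[OF that] by (simp add: divide_simps mult_ac)
  qed
  then have "bdd_above ((\<lambda>z. \<nu> (M *v z) / \<nu> z) ` {z. z \<noteq> 0})"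
    by (intro bdd_aboveI2) auto
  then have "\<nu> (M *v x) / \<nu> x \<le> induced_norm \<nu> M"
    unfolding induced_norm_def using False by (intro cSUP_upper) auto
  then show ?thesis using pos[OF False] by (simp add: divide_simps)
next
  case True
  interpret equivalent_norm \<nu> by (rule equivalent_norm_vector_norm[OF assms])
  show ?thesis using True by simp
qed

section \<open>Running maxima\<close>

text \<open>Continuity on a compact interval makes the values bounded, so the supremum is a genuine
  upper bound.\<close>

lemma le_max_upto:
  assumes "continuous_on {0..T} h" "t \<le> T" "s \<in> {0..t}"
  shows "h s \<le> max_upto t h"
proof -
  have "compact (h ` {0..t})"
    using assms by (intro compact_continuous_image) (auto intro: continuous_on_subset)
  then show ?thesis
    unfolding max_upto_def using assms
    by (intro cSUP_upper bounded_imp_bdd_above compact_imp_bounded)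
qed

lemma max_upto_le:
  assumes "0 \<le> t" "\<And>s. s \<in> {0..t} \<Longrightarrow> h s \<le> B"
  shows "max_upto t h \<le> B"
  unfolding max_upto_def using assms by (intro cSUP_least) auto

section \<open>Error recursion and convergence\<close>

theorem proposition5:
  fixes \<nu> :: "complex ^ 'n \<Rightarrow> real"
    and T L C \<omega> \<delta> \<eta> :: real
    and v :: "real ^ 'n"
    and \<Phi> :: "real \<Rightarrow> real ^ 'n \<Rightarrow> real ^ 'n"
    and A :: "nat \<Rightarrow> real ^ 'n ^ 'n"
    and f :: "nat \<Rightarrow> real ^ 'n \<Rightarrow> real ^ 'n"
    and g :: "real \<Rightarrow> real ^ 'n"
    and y :: "real \<Rightarrow> real ^ 'n"
    and yt :: "nat \<Rightarrow> real \<Rightarrow> real ^ 'n"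
  assumes norm: "is_vector_norm \<nu>"
    and T: "T > 0"
    and g: "continuous_on UNIV g"
    and y_ode: "\<And>t. t \<in> {0..T} \<Longrightarrow> (y has_vector_derivative \<Phi> t (y t)) (at t within {0..T})"
    and y_init: "y 0 = v"
    and split: "\<And>k t u. t \<ge> 0 \<Longrightarrow> \<Phi> t u = - (A k *v u) + f k u + g t"
    and const_bounds: "L \<ge> 0" "C > 0" "\<omega> \<ge> 0"
    and lipschitz: "\<And>k u w. \<nu> (cvec (f k u - f k w)) \<le> L * \<nu> (cvec (u - w))"
    and exp_bound: "\<And>k t. t \<ge> 0 \<Longrightarrow>
          induced_norm \<nu> (cmat (mat_exp ((- t) *\<^sub>R A k))) \<le> C * exp (- \<omega> * t)"
    and \<delta>: "\<delta> \<in> {0<..<1}"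
    and contraction: "C * L * T * phi1 (- \<omega> * T) \<le> \<delta>"
    and initial_guess: "continuous_on {0..T} (yt 0)"
    and iterates: "\<And>k. k \<ge> 1 \<Longrightarrow> cont_diff_on_interval T (yt k)"
    and iterates_init: "\<And>k. yt k 0 = v"
    and \<eta>: "\<eta> \<in> {0<..<1}"
    and residual: "\<And>k.
          (\<forall>t\<in>{0..T}. \<nu> (cvec (lin_residual T (A k) (f k) g (yt k) (yt (Suc k)) t))
              \<le> \<eta> * max_upto t (\<lambda>s. \<nu> (cvec (f k (yt (Suc k) s) - f k (yt k s)))))
        \<or> (\<forall>t\<in>{0..T}. \<nu> (cvec (lin_residual T (A k) (f k) g (yt k) (yt (Suc k)) t))
              \<le> \<eta> * L * max_upto t (\<lambda>s. \<nu> (cvec (yt (Suc k) s - yt k s))))"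
  shows "(\<forall>k. \<forall>t\<in>{0..T}.
            \<nu> (cvec (y t - yt (Suc k) t))
              \<le> ((1 + \<eta>) * (C * L * t * phi1 (- \<omega> * t))) / (1 - \<eta> * (C * L * t * phi1 (- \<omega> * t)))
                 * max_upto t (\<lambda>s. \<nu> (cvec (y s - yt k s))))
       \<and> (\<eta> < (1 - \<delta>) / (2 * \<delta>) \<longrightarrow>
            (\<forall>t\<in>{0..T}. (\<lambda>k. yt k t) \<longlonglongrightarrow> y t))"
proof -
  define p where "p x = \<nu> (cvec x)" for x
  interpret p: equivalent_norm p
    unfolding p_def by (rule equivalent_norm_cvec[OF norm])
  define e where "e k s = y s - yt k s" for k s
  define M where "M k t = max_upto t (\<lambda>s. p (e k s))" for k t
  define a where "a t = C * L * t * phi1 (- \<omega> * t)" for t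

  have yt_deriv: "(yt (Suc k) has_vector_derivative vector_derivative (yt (Suc k)) (at s within {0..T}))
      (at s within {0..T})" if "s \<in> {0..T}" for k s
    using iterates[of "Suc k"] that by (simp add: cont_diff_on_interval_def vector_derivative_works)
  have yt_cont: "continuous_on {0..T} (yt k)" for k
  \<comment> \<open>The initial guess is only assumed continuous; the later iterates are continuous
    because they are differentiable.\<close>
  proof (cases k)
    case (Suc m)
    then show ?thesis
      by (auto intro: continuous_on_vector_derivative yt_deriv)
  qed (simp add: initial_guess)
  have y_cont: "continuous_on {0..T} y"
    by (rule continuous_on_vector_derivative[OF y_ode])
  have e_cont: "continuous_on {0..T} (\<lambda>s. p (e k s))" for k
    unfolding e_def by (intro p.continuous_on_compose continuous_on_diff y_cont yt_cont)
  have le_M: "p (e k s) \<le> M k t" if "t \<le> T" "s \<in> {0..t}" for k s t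
    unfolding M_def using e_cont that by (rule le_max_upto)
  have M_nonneg: "0 \<le> M k t" if "t \<in> {0..T}" for k t
    by (rule order_trans[OF p.nonneg le_M[of t 0]]) (use that in auto)

  \<comment> \<open>Monotonicity of \<open>t * phi1 (- \<omega> * t)\<close> carries the contraction
    condition from \<open>T\<close> to every earlier time.\<close>
  have a_bounds: "0 \<le> a t" "a t \<le> \<delta>" if "t \<in> {0..T}" for t
  proof -
    have "0 \<le> t * phi1 (- \<omega> * t)" "t * phi1 (- \<omega> * t) \<le> T * phi1 (- \<omega> * T)"
      using mult_phi1_mono[of 0 t \<omega>] mult_phi1_mono[of t T \<omega>] that by auto
    then have "0 \<le> C * L * (t * phi1 (- \<omega> * t))"
      "C * L * (t * phi1 (- \<omega> * t)) \<le> C * L * (T * phi1 (- \<omega> * T))"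
      using const_bounds by (auto intro!: mult_left_mono mult_nonneg_nonneg)
    then show "0 \<le> a t" "a t \<le> \<delta>"
      using contraction unfolding a_def mult.assoc by linarith+
  qed
  have denom: "0 < 1 - \<eta> * a t" if "t \<in> {0..T}" for t
  proof -
    have "\<eta> * a t \<le> 1 * \<delta>"
      using a_bounds[OF that] \<eta> by (intro mult_mono) auto
    then show ?thesis using \<delta> by simp
  qed

  have semigroup: "p (mat_exp ((- s) *\<^sub>R A k) *v x) \<le> C * exp (- \<omega> * s) * p x" if "0 \<le> s" for k s x
  proof -
    have "p (mat_exp ((- s) *\<^sub>R A k) *v x) \<le> induced_norm \<nu> (cmat (mat_exp ((- s) *\<^sub>R A k))) * p x"
      unfolding p_def cvec_mult by (rule induced_norm_bound[OF norm])
    also have "\<dots> \<le> C * exp (- \<omega> * s) * p x"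
      by (intro mult_right_mono exp_bound that p.nonneg)
    finally show ?thesis .
  qed

  define r where "r k = lin_residual T (A k) (f k) g (yt k) (yt (Suc k))" for k
  have e_deriv: "(e (Suc k) has_vector_derivative
      - (A k *v e (Suc k) s) + (f k (y s) - f k (yt k s) + r k s)) (at s within {0..t})"
    if "s \<in> {0..t}" "t \<le> T" for k s t
  proof -
    have s: "s \<in> {0..T}" using that by auto
    have "(e (Suc k) has_vector_derivative
        \<Phi> s (y s) - vector_derivative (yt (Suc k)) (at s within {0..T})) (at s within {0..T})"
      unfolding e_def by (intro has_vector_derivative_diff y_ode yt_deriv s)
    \<comment> \<open>\<Phi> is split with the index \<open>k\<close> of the current sweep; then
      \<open>g\<close> cancels against the residual and \<open>A k\<close> acts on the new error
      only.\<close>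
    moreover have "\<Phi> s (y s) - vector_derivative (yt (Suc k)) (at s within {0..T})
        = - (A k *v e (Suc k) s) + (f k (y s) - f k (yt k s) + r k s)"
      using split[of s "y s" k] s
      by (simp add: r_def lin_residual_def e_def matrix_vector_mult_diff_distrib algebra_simps)
    ultimately show ?thesis
      using that by (auto intro: has_vector_derivative_within_subset)
  qed

  \<comment> \<open>Inserting \<open>y\<close> between consecutive iterates bounds their difference
    by two errors. Under the first alternative the Lipschitz bound supplies the factor
    \<open>L\<close> that the second one already contains.\<close>
  have residual_le: "p (r k s) \<le> \<eta> * L * (M (Suc k) t + M k t)"
    if "s \<in> {0..t}" "t \<le> T" for k s t
  proof -
    have s: "0 \<le> s" "s \<in> {0..T}" using that by auto
    have diff_le: "p (yt (Suc k) x - yt k x) \<le> M (Suc k) t + M k t" if x: "x \<in> {0..s}" for x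
    proof -
      have "p (yt (Suc k) x - yt k x) \<le> p (e (Suc k) x) + p (e k x)"
        using p.triangle_diff[of "yt (Suc k) x" "yt k x" "y x"] p.diff_commute[of "y x"]
        by (simp add: e_def)
      also have "\<dots> \<le> M (Suc k) t + M k t"
        using x \<open>s \<in> {0..t}\<close> \<open>t \<le> T\<close> by (intro add_mono le_M) auto
      finally show ?thesis .
    qed
    then have "max_upto s (\<lambda>x. p (yt (Suc k) x - yt k x)) \<le> M (Suc k) t + M k t"
      by (intro max_upto_le s)
    then have b: "\<eta> * L * max_upto s (\<lambda>x. p (yt (Suc k) x - yt k x)) \<le> \<eta> * L * (M (Suc k) t + M k t)"
      using \<eta> const_bounds by (intro mult_left_mono) auto
    have "p (f k (yt (Suc k) x) - f k (yt k x)) \<le> L * (M (Suc k) t + M k t)" if "x \<in> {0..s}" for x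
      using lipschitz[of k "yt (Suc k) x" "yt k x"] mult_left_mono[OF diff_le[OF that], of L] const_bounds
      by (simp add: p_def)
    then have "max_upto s (\<lambda>x. p (f k (yt (Suc k) x) - f k (yt k x))) \<le> L * (M (Suc k) t + M k t)"
      by (intro max_upto_le s)
    then have "\<eta> * max_upto s (\<lambda>x. p (f k (yt (Suc k) x) - f k (yt k x))) \<le> \<eta> * L * (M (Suc k) t + M k t)"
      unfolding mult.assoc using \<eta> by (intro mult_left_mono) auto
    with b residual[of k] s(2) show ?thesis
      unfolding r_def p_def by (blast intro: order_trans)
  qed

  have M_Suc: "M (Suc k) t \<le> (1 + \<eta>) * a t / (1 - \<eta> * a t) * M k t" if t: "t \<in> {0..T}" for k t
  proof -
    \<comment> \<open>A bound for the source uniform on \<open>{0..t}\<close>. It contains the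
      unknown \<open>M (Suc k) t\<close> itself, so the resulting estimate is implicit.\<close>
    let ?B = "L * M k t + \<eta> * L * (M (Suc k) t + M k t)"
    have "0 \<le> ?B"
      using const_bounds \<eta> M_nonneg[OF t] by auto
    have source: "p (f k (y s) - f k (yt k s) + r k s) \<le> ?B" if "s \<in> {0..t}" for s
    proof -
      have "p (f k (y s) - f k (yt k s)) \<le> L * p (e k s)"
        using lipschitz by (simp add: p_def e_def)
      also have "\<dots> \<le> L * M k t"
        using le_M[of t s k] that t const_bounds by (intro mult_left_mono) auto
      finally show ?thesis
        using residual_le[of s t k] p.triangle[of "f k (y s) - f k (yt k s)" "r k s"] that t by auto
    qed
    \<comment> \<open>The estimate is made at every \<open>s\<close> up to \<open>t\<close>, with a
      right-hand side free of \<open>s\<close>, so that the maximum can be taken on the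
      left.\<close>
    have "p (e (Suc k) s) \<le> C * ?B * (t * phi1 (- \<omega> * t))" if s: "s \<in> {0..t}" for s
    proof -
      have "p (e (Suc k) s) \<le> C * ?B * (s * phi1 (- \<omega> * s))"
      proof (rule duhamel_bound[OF p.equivalent_norm_axioms])
        show "(e (Suc k) has_vector_derivative
            - (A k *v e (Suc k) x) + (f k (y x) - f k (yt k x) + r k x)) (at x within {0..s})"
          if "x \<in> {0..s}" for x
          using e_deriv that s t by auto
        show "p (f k (y x) - f k (yt k x) + r k x) \<le> ?B" if "x \<in> {0..s}" for x
          using source that s by auto
      qed (use s const_bounds semigroup in \<open>auto simp: e_def y_init iterates_init\<close>)
      also have "\<dots> \<le> C * ?B * (t * phi1 (- \<omega> * t))"
        using \<open>0 \<le> ?B\<close> const_bounds s by (intro mult_left_mono mult_phi1_mono) auto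
      finally show ?thesis .
    qed
    then have "M (Suc k) t \<le> C * ?B * (t * phi1 (- \<omega> * t))"
      unfolding M_def using t by (intro max_upto_le) auto
    also have "\<dots> = a t * ((1 + \<eta>) * M k t + \<eta> * M (Suc k) t)"
      by (simp add: a_def algebra_simps)
    \<comment> \<open>The term with \<open>M (Suc k) t\<close> is absorbed on the left; its
      coefficient is positive by \<open>denom\<close>.\<close>
    finally have "(1 - \<eta> * a t) * M (Suc k) t \<le> (1 + \<eta>) * a t * M k t"
      by (simp add: algebra_simps)
    then show ?thesis
      using denom[OF t] by (simp add: pos_le_divide_eq mult.commute)
  qed

  have "\<forall>k. \<forall>t\<in>{0..T}. p (e (Suc k) t) \<le> (1 + \<eta>) * a t / (1 - \<eta> * a t) * M k t"
    using M_Suc le_M order_trans by (metis atLeastAtMost_iff order_refl)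
  moreover have "\<forall>t\<in>{0..T}. (\<lambda>k. yt k t) \<longlonglongrightarrow> y t" if small: "\<eta> < (1 - \<delta>) / (2 * \<delta>)"
  proof
    fix t assume t: "t \<in> {0..T}"
    define q where "q = (1 + \<eta>) * a t / (1 - \<eta> * a t)"
    \<comment> \<open>The assumed bound on \<eta> is equivalent to
      \<open>(1 + 2 * \<eta>) * \<delta> < 1\<close>. With \<open>a t\<close> in place of \<delta>
      this says that the numerator of \<open>q\<close> is below its denominator.\<close>
    have "(1 + 2 * \<eta>) * a t \<le> (1 + 2 * \<eta>) * \<delta>"
      using a_bounds[OF t] \<eta> by (intro mult_left_mono) auto
    also have "\<dots> < 1"
      using small \<delta> by (simp add: pos_less_divide_eq algebra_simps)
    finally have "(1 + \<eta>) * a t < 1 - \<eta> * a t"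
      by (simp add: algebra_simps)
    then have q: "0 \<le> q" "q < 1"
      using denom[OF t] a_bounds[OF t] \<eta> by (simp_all add: q_def)
    have "M k t \<le> q ^ k * M 0 t" for k
    proof (induction k)
      case (Suc k)
      then show ?case
        using M_Suc[OF t, of k] mult_left_mono[OF Suc q(1)] by (simp add: q_def mult.assoc)
    qed simp
    then have bound: "norm (p (yt k t - y t)) \<le> q ^ k * M 0 t" for k
      using le_M[of t t k] t p.diff_commute[of "yt k t" "y t"] by (auto simp: e_def intro: order_trans)
    have "(\<lambda>k. q ^ k * M 0 t) \<longlonglongrightarrow> 0"
      using q by (intro tendsto_mult_left_zero LIMSEQ_realpow_zero) auto
    then have "(\<lambda>k. p (yt k t - y t)) \<longlonglongrightarrow> 0"
      by (rule Lim_null_comparison[OF always_eventually[OF allI[OF bound]]])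
    then show "(\<lambda>k. yt k t) \<longlonglongrightarrow> y t"
      by (rule p.tendsto_from_zero)
  qed
  ultimately show ?thesis
    unfolding p_def e_def M_def a_def by blast
qed

end
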